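(* Let $f:\mathbb{R}^n\to\mathbb{R}$ be continuously differentiable with gradient Lipschitz continuous on the unit simplex $\Delta$ with constant $L>0$. Let $C>0$ and let the parameter $\epsilon$ of the active-set estimate satisfy $0<\epsilon\le\frac{2}{nL(2C+1)}$. Let $\{x^k\}$ be the infinite sequence generated by the algorithm AS-SIMPLEX (described in the context), with $d^k$ computed by the (FW) rule and with the exact line search, and assume $\lim_{k\to\infty}x^k=x^*$, where $x^*$ is a stationary point of $\min_{x\in\Delta}f(x)$. Let $\bar N=\{i: x^*_i>0\}$, assume $f$ is strongly convex on $\Delta_{\bar N}$, and assume strict complementarity holds at $x^*$. Then there exists $\bar k$ such that $$f(x^{k+1})-f(x^* )\le(1-\rho^{\text{AS-FW}})\,[f(x^k)-f(x^* )]\quad\text{for all }k\ge\bar k,$$ where $$\rho^{\text{AS-FW}}=\min\Bigl\{\tfrac12,\ \frac{\mu_f(\bar N)}{C_f(\bar N)}\Bigr\}.$$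
   Context: Setting. $\Delta=\{x\in\mathbb{R}^n: e^Tx=1,\ x\ge 0\}$, where $e$ is the all-ones vector; $e_i$ is the $i$th unit vector; $v_I$ is the subvector of $v$ with components indexed by $I$. For $I\subseteq\{1,\dots,n\}$, $\Delta_I=\{x\in\Delta: x_i=0\ \forall i\notin I\}$. A point $x^*\in\Delta$ is stationary (for $\min_\Delta f$) if there are $\lambda^*\in\mathbb{R}$, $\mu^*\in\mathbb{R}^n$ with $\nabla f(x^* )-\lambda^*e-\mu^*=0$, $(\mu^* )^Tx^*=0$, $\mu^*\ge0$; these multipliers are $\lambda^*=\nabla f(x^* )^Tx^*$ and $\mu^*=\nabla f(x^* )-\lambda^*e$. Strict complementarity holds at $x^*$ if $\mu^*_i>0$ for every $i$ with $x^*_i=0$. Active-set estimate. For $x\in\Delta$ and the fixed parameter $\epsilon>0$: $A(x)=\{i: x_i\le\epsilon\nabla f(x)^T(e_i-x)\}$, $N(x)=\{i: x_i>\epsilon\nabla f(x)^T(e_i-x)\}$, and $J(x)=\operatorname{Argmin}_{i=1,\dots,n}\nabla_i f(x)$. Algorithm AS-SIMPLEX. Choose $x^0\in\Delta$. For $k=0,1,\dots$: if $x^k$ is stationary, stop. Otherwise set $A^k=A(x^k)$, $N^k=N(x^k)$, choose $j\in J(x^k)$ (for non-stationary $x^k$ one has $J(x^k)\subseteq N(x^k)$), and set $\tilde x^k_{A^k}=0$, $\tilde x^k_{i}=x^k_{i}$ for $i\in N^k\setminus\{j\}$, $\tilde x^k_j=x^k_j+\sum_{h\in A^k}x^k_h$.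 Compute a direction $d^k$ that is feasible for $\Delta$ at $\tilde x^k$ and satisfies $d^k_{A^k}=0$. If $\nabla f(\tilde x^k)^Td^k<0$, compute a stepsize $\alpha^k\in(0,\alpha^k_{\max}]$ by a line search; otherwise set $\alpha^k=0$. Set $x^{k+1}=\tilde x^k+\alpha^kd^k$. Here $\alpha^k_{\max}$ is the maximum feasible stepsize, i.e. the largest $\alpha$ with $\tilde x^k+\alpha d^k\in\Delta$. Exact line search: $\alpha^k\in\operatorname{Argmin}_{\alpha\in(0,\alpha^k_{\max}]}f(\tilde x^k+\alpha d^k)$. (FW) rule: $d^k_{A^k}=0$ and $d^k_{N^k}=(e_{\hat\imath}-\tilde x^k)_{N^k}$ with $\hat\imath\in\operatorname{Argmin}_{i\in N^k}\nabla_if(\tilde x^k)$. Constants. For $I\subseteq\{1,\dots,n\}$, $$C_f(I)=\sup\Bigl\{\tfrac{2}{\alpha^2}\bigl[f(y)-f(x)-\nabla f(x)^T(y-x)\bigr]:\ x,s\in\Delta_I,\ \alpha\in(0,1],\ y=x+\alpha(s-x)\Bigr\},$$ $$\mu_f(I)=\inf\Bigl\{\tfrac{2}{\alpha^2}\bigl[f(y)-f(x)-\nabla f(x)^T(y-x)\bigr]:\ x\in\Delta_I\setminus\{x^*\},\ \alpha\in(0,1],\ \bar s=\bar s(x,x^*,\Delta),\ y=x+\alpha(\bar s-x)\Bigr\},$$ where $\bar s(x,x^*,\Delta)$ is the point at which the ray from $x$ through $x^*$ leaves $\Delta$, i.e. the last point of that ray belonging to $\Delta$. *)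

theory Defs
  imports "HOL-Analysis.Analysis"
begin

text \<open>
  Points of \<open>\<real>\<^sup>n\<close> have type \<^typ>\<open>real ^ 'n\<close> with \<open>n = CARD('n)\<close>. The constant \<open>1\<close> of this type is the
  all-ones vector \<open>e\<close>, and \<open>axis i 1\<close> is the unit vector \<open>e\<^sub>i\<close>. Throughout, \<open>g\<close> stands for the
  gradient of the objective \<open>f\<close>.
\<close>

definition unit_simplex :: "(real ^ 'n) set" where
  "unit_simplex = {x. 1 \<bullet> x = 1 \<and> (\<forall>i. 0 \<le> x $ i)}"

definition face :: "'n set \<Rightarrow> (real ^ 'n) set" where
  "face I = {x \<in> unit_simplex. \<forall>i. i \<notin> I \<longrightarrow> x $ i = 0}"

definition strongly_convex_on :: "'a::real_inner set \<Rightarrow> ('a \<Rightarrow> real) \<Rightarrow> bool" where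
  "strongly_convex_on S f \<longleftrightarrow> (\<exists>m>0. \<forall>x\<in>S. \<forall>y\<in>S. \<forall>t\<in>{0..1}.
     f (t *\<^sub>R x + (1 - t) *\<^sub>R y)
       \<le> t * f x + (1 - t) * f y - m / 2 * t * (1 - t) * (norm (x - y))\<^sup>2)"

subsection \<open>Stationarity and strict complementarity\<close>

definition stationary :: "(real ^ 'n \<Rightarrow> real ^ 'n) \<Rightarrow> real ^ 'n \<Rightarrow> bool" where
  "stationary g x \<longleftrightarrow> x \<in> unit_simplex \<and>
     (\<exists>(lam::real) (mu::real ^ 'n). g x - lam *\<^sub>R 1 - mu = 0 \<and> mu \<bullet> x = 0 \<and> (\<forall>i. 0 \<le> mu $ i))"

text \<open>At a stationary point the multipliers are unique and given by the following formulas.\<close>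

definition lam_mult :: "(real ^ 'n \<Rightarrow> real ^ 'n) \<Rightarrow> real ^ 'n \<Rightarrow> real" where
  "lam_mult g x = g x \<bullet> x"

definition mu_mult :: "(real ^ 'n \<Rightarrow> real ^ 'n) \<Rightarrow> real ^ 'n \<Rightarrow> real ^ 'n" where
  "mu_mult g x = g x - lam_mult g x *\<^sub>R 1"

definition strict_complementarity :: "(real ^ 'n \<Rightarrow> real ^ 'n) \<Rightarrow> real ^ 'n \<Rightarrow> bool" where
  "strict_complementarity g x \<longleftrightarrow> (\<forall>i. x $ i = 0 \<longrightarrow> 0 < mu_mult g x $ i)"

subsection \<open>The algorithm\<close>

definition active_set :: "(real ^ 'n \<Rightarrow> real ^ 'n) \<Rightarrow> real \<Rightarrow> real ^ 'n \<Rightarrow> 'n set" where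
  "active_set g eps x = {i. x $ i \<le> eps * (g x \<bullet> (axis i 1 - x))}"

definition nonactive_set :: "(real ^ 'n \<Rightarrow> real ^ 'n) \<Rightarrow> real \<Rightarrow> real ^ 'n \<Rightarrow> 'n set" where
  "nonactive_set g eps x = {i. x $ i > eps * (g x \<bullet> (axis i 1 - x))}"

definition min_grad_set :: "(real ^ 'n \<Rightarrow> real ^ 'n) \<Rightarrow> real ^ 'n \<Rightarrow> 'n set" where
  "min_grad_set g x = {j. is_arg_min (\<lambda>i. g x $ i) (\<lambda>i. True) j}"

definition tilde_point :: "'n set \<Rightarrow> 'n \<Rightarrow> real ^ 'n \<Rightarrow> real ^ 'n" where
  "tilde_point A j x =
     (\<chi> i. if i \<in> A then 0 else if i = j then x $ j + (\<Sum>h\<in>A. x $ h) else x $ i)"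

definition feasible_direction :: "real ^ 'n \<Rightarrow> real ^ 'n \<Rightarrow> bool" where
  "feasible_direction x d \<longleftrightarrow> (\<exists>a>0. \<forall>t\<in>{0..a}. x + t *\<^sub>R d \<in> unit_simplex)"

text \<open>The maximum exists whenever \<open>x\<close> is feasible and \<open>d \<noteq> 0\<close>, since the simplex is compact.\<close>

definition max_stepsize :: "real ^ 'n \<Rightarrow> real ^ 'n \<Rightarrow> real" where
  "max_stepsize x d = (GREATEST t. x + t *\<^sub>R d \<in> unit_simplex)"

definition exact_line_search :: "(real ^ 'n \<Rightarrow> real) \<Rightarrow> real ^ 'n \<Rightarrow> real ^ 'n \<Rightarrow> real \<Rightarrow> bool" where
  "exact_line_search f x d a \<longleftrightarrow>
     is_arg_min (\<lambda>t. f (x + t *\<^sub>R d)) (\<lambda>t. t \<in> {0<..max_stepsize x d}) a"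

definition fw_direction ::
  "(real ^ 'n \<Rightarrow> real ^ 'n) \<Rightarrow> 'n set \<Rightarrow> 'n set \<Rightarrow> real ^ 'n \<Rightarrow> real ^ 'n \<Rightarrow> bool" where
  "fw_direction g A N xt d \<longleftrightarrow> (\<exists>ih. is_arg_min (\<lambda>i. g xt $ i) (\<lambda>i. i \<in> N) ih \<and>
     (\<forall>i\<in>A. d $ i = 0) \<and> (\<forall>i\<in>N. d $ i = (axis ih 1 - xt) $ i))"

text \<open>
  One iteration; \<open>dir A N xt d\<close> is the rule for the search direction and \<open>ls xt d a\<close> the line search.
  All choices (of \<open>j\<close>, of the direction, of the stepsize) are nondeterministic.
\<close>

definition as_simplex_step ::
  "(real ^ 'n \<Rightarrow> real ^ 'n) \<Rightarrow> real \<Rightarrow>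
   ('n set \<Rightarrow> 'n set \<Rightarrow> real ^ 'n \<Rightarrow> real ^ 'n \<Rightarrow> bool) \<Rightarrow>
   (real ^ 'n \<Rightarrow> real ^ 'n \<Rightarrow> real \<Rightarrow> bool) \<Rightarrow> real ^ 'n \<Rightarrow> real ^ 'n \<Rightarrow> bool" where
  "as_simplex_step g eps dir ls x x' \<longleftrightarrow>
     (let A = active_set g eps x; N = nonactive_set g eps x in
      \<exists>j\<in>min_grad_set g x. \<exists>xt d a.
        xt = tilde_point A j x \<and>
        feasible_direction xt d \<and> (\<forall>i\<in>A. d $ i = 0) \<and> dir A N xt d \<and>
        (if g xt \<bullet> d < 0 then a \<in> {0<..max_stepsize xt d} \<and> ls xt d a else a = 0) \<and>
        x' = xt + a *\<^sub>R d)"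

text \<open>The algorithm stops at stationary points, so no iterate of an infinite run is stationary.\<close>

definition as_simplex_infinite_run ::
  "(real ^ 'n \<Rightarrow> real ^ 'n) \<Rightarrow> real \<Rightarrow>
   ('n set \<Rightarrow> 'n set \<Rightarrow> real ^ 'n \<Rightarrow> real ^ 'n \<Rightarrow> bool) \<Rightarrow>
   (real ^ 'n \<Rightarrow> real ^ 'n \<Rightarrow> real \<Rightarrow> bool) \<Rightarrow> (nat \<Rightarrow> real ^ 'n) \<Rightarrow> bool" where
  "as_simplex_infinite_run g eps dir ls x \<longleftrightarrow> x 0 \<in> unit_simplex \<and>
     (\<forall>k. \<not> stationary g (x k) \<and> as_simplex_step g eps dir ls (x k) (x (Suc k)))"

subsection \<open>The curvature constants\<close>

definition curvature_term ::
  "(real ^ 'n \<Rightarrow> real) \<Rightarrow> (real ^ 'n \<Rightarrow> real ^ 'n) \<Rightarrow> real \<Rightarrow> real ^ 'n \<Rightarrow> real ^ 'n \<Rightarrow> real" where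
  "curvature_term f g a x y = 2 / a\<^sup>2 * (f y - f x - g x \<bullet> (y - x))"

definition exit_point :: "real ^ 'n \<Rightarrow> real ^ 'n \<Rightarrow> (real ^ 'n) set \<Rightarrow> real ^ 'n" where
  "exit_point x z S = x + (GREATEST t. 0 \<le> t \<and> x + t *\<^sub>R (z - x) \<in> S) *\<^sub>R (z - x)"

text \<open>
  Supremum and infimum are taken in the extended reals. If \<open>face I = {xs}\<close>, the infimum is over the
  empty set, so that \<open>mu_const\<close> is \<open>\<infinity>\<close> while \<open>C_const\<close> is \<open>0\<close>; their quotient is then \<open>\<infinity>\<close> and the
  rate below is \<open>1/2\<close>.
\<close>

definition C_const ::
  "(real ^ 'n \<Rightarrow> real) \<Rightarrow> (real ^ 'n \<Rightarrow> real ^ 'n) \<Rightarrow> 'n set \<Rightarrow> ereal" where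
  "C_const f g I = Sup {ereal (curvature_term f g a x y) | x s a y.
     x \<in> face I \<and> s \<in> face I \<and> a \<in> {0<..1} \<and> y = x + a *\<^sub>R (s - x)}"

definition mu_const ::
  "(real ^ 'n \<Rightarrow> real) \<Rightarrow> (real ^ 'n \<Rightarrow> real ^ 'n) \<Rightarrow> real ^ 'n \<Rightarrow> 'n set \<Rightarrow> ereal" where
  "mu_const f g xs I = Inf {ereal (curvature_term f g a x y) | x sb a y.
     x \<in> face I - {xs} \<and> a \<in> {0<..1} \<and> sb = exit_point x xs unit_simplex \<and>
     y = x + a *\<^sub>R (sb - x)}"

text \<open>For \<open>f\<close> convex on \<open>face I\<close> and \<open>xs \<in> face I\<close> the minimum lies in \<open>[0, 1/2]\<close>, so it is a real.\<close>

definition rho_AS_FW ::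
  "(real ^ 'n \<Rightarrow> real) \<Rightarrow> (real ^ 'n \<Rightarrow> real ^ 'n) \<Rightarrow> real ^ 'n \<Rightarrow> 'n set \<Rightarrow> real" where
  "rho_AS_FW f g xs I = real_of_ereal (min (1 / 2) (mu_const f g xs I / C_const f g I))"

end

theory Submission
  imports Defs
begin

text \<open>
  By strict complementarity the active-set estimate is exact near \<open>xs\<close>: from some iteration on, the
  estimated active set is the complement of \<open>Nbar\<close>. There, moving mass from a coordinate outside
  \<open>Nbar\<close> to one inside does not increase \<open>f\<close>, because the gradient components outside \<open>Nbar\<close> are
  strictly larger in a whole neighbourhood of \<open>xs\<close>. What remains is a Frank-Wolfe step with exact
  line search on the face of \<open>Nbar\<close>. With Frank-Wolfe gap \<open>G\<close> and \<open>h = f x - f xs\<close>, the constant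
  \<open>mu\<close> gives \<open>h \<le> t G - t\<^sup>2 mu / 2 \<le> G\<^sup>2 / (2 mu)\<close>, and the constant \<open>C\<close> gives a decrease of at least
  \<open>G\<^sup>2 / (2 C)\<close> if \<open>G \<le> C\<close> and of at least \<open>G / 2 \<ge> h / 2\<close> otherwise.
\<close>

section \<open>Faces of the simplex and rays inside it\<close>

lemma unit_simplex_iff:
  "x \<in> unit_simplex \<longleftrightarrow> (\<Sum>i\<in>UNIV. x $ i) = 1 \<and> (\<forall>i. 0 \<le> x $ i)"
  by (simp add: unit_simplex_def inner_vec_def)

lemma convex_face: "convex (face I)"
  unfolding convex_def face_def unit_simplex_def
  by (auto simp: inner_add_right)

lemma face_UNIV: "face UNIV = unit_simplex"
  by (simp add: face_def)

lemma face_subset_unit_simplex: "face I \<subseteq> unit_simplex"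
  by (auto simp: face_def)

lemma convex_unit_simplex: "convex unit_simplex"
  using convex_face[of UNIV] by (simp add: face_UNIV)

lemma axis_in_face: "i \<in> I \<Longrightarrow> axis i 1 \<in> face I"
  by (auto simp: face_def unit_simplex_iff axis_def)

lemma segment_in_convex:
  assumes "convex S" "x \<in> S" "x + b *\<^sub>R d \<in> S" "0 \<le> t" "t \<le> b"
  shows "x + t *\<^sub>R d \<in> S"
proof (cases "b = 0")
  case True
  then show ?thesis using assms by simp
next
  case False
  then have "b > 0" using assms by simp
  have "(1 - t / b) *\<^sub>R x + (t / b) *\<^sub>R (x + b *\<^sub>R d) \<in> S"
    using assms \<open>b > 0\<close> by (intro convexD) (auto simp: field_simps)
  moreover have "(1 - t / b) *\<^sub>R x + (t / b) *\<^sub>R (x + b *\<^sub>R d) = x + t *\<^sub>R d"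
    using \<open>b > 0\<close> by (simp add: algebra_simps)
  ultimately show ?thesis by simp
qed

text \<open>The weights \<open>y\<close> sum to 1 and vanish off \<open>I\<close>, so
  \<open>v \<bullet> y\<close> is an average of the components of \<open>v\<close> over
  \<open>I\<close>.\<close>

lemma inner_ge_on_face:
  assumes "y \<in> face I" "\<And>i. i \<in> I \<Longrightarrow> c \<le> v $ i"
  shows "c \<le> v \<bullet> y"
proof -
  have "c = (\<Sum>i\<in>UNIV. c * y $ i)"
    using assms(1) by (simp add: face_def unit_simplex_iff flip: sum_distrib_left)
  also have "\<dots> \<le> (\<Sum>i\<in>UNIV. v $ i * y $ i)"
  proof (rule sum_mono)
    fix i
    show "c * y $ i \<le> v $ i * y $ i"
      using assms by (cases "i \<in> I") (auto simp: face_def unit_simplex_iff mult_right_mono)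
  qed
  also have "\<dots> = v \<bullet> y" by (simp add: inner_vec_def)
  finally show ?thesis .
qed

text \<open>A nonzero direction whose components sum to 0 has a negative component, and the sign
  constraint on that coordinate bounds the step.\<close>

lemma ray_exit_bound:
  assumes x: "x \<in> unit_simplex" and d: "1 \<bullet> d = 0" "d \<noteq> 0"
  shows "\<exists>B. \<forall>t. 0 \<le> t \<longrightarrow> x + t *\<^sub>R d \<in> unit_simplex \<longrightarrow> t \<le> B"
proof -
  have "\<exists>i. d $ i < 0"
  proof (rule ccontr)
    assume "\<not> ?thesis"
    then have nn: "\<forall>i. 0 \<le> d $ i" by (meson not_le)
    have "(\<Sum>i\<in>UNIV. d $ i) = 0" using d(1) by (simp add: inner_vec_def)
    then have "\<forall>i. d $ i = 0" using nn by (simp add: sum_nonneg_eq_0_iff)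
    then show False using d(2) by (simp add: vec_eq_iff)
  qed
  then obtain i where i: "d $ i < 0" by blast
  have "t \<le> x $ i / (- d $ i)" if "x + t *\<^sub>R d \<in> unit_simplex" for t
  proof -
    have "0 \<le> x $ i + t * d $ i" using that by (auto simp: unit_simplex_def)
    then show ?thesis using i by (simp add: field_simps)
  qed
  then show ?thesis by blast
qed

lemma closed_unit_simplex: "closed unit_simplex"
  unfolding unit_simplex_def
  by (intro closed_Collect_conj closed_Collect_all closed_Collect_eq closed_Collect_le continuous_intros)

text \<open>\<open>GREATEST\<close> has the expected meaning only if a maximum exists. Here it does:
  the set of feasible steps is closed, bounded and contains 0.\<close>

lemma Greatest_ray_properties:
  assumes x: "x \<in> unit_simplex" and d: "1 \<bullet> d = 0" "d \<noteq> 0"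
  defines "T \<equiv> GREATEST t. 0 \<le> t \<and> x + t *\<^sub>R d \<in> unit_simplex"
  shows "x + T *\<^sub>R d \<in> unit_simplex" "\<And>t. 0 \<le> t \<Longrightarrow> x + t *\<^sub>R d \<in> unit_simplex \<Longrightarrow> t \<le> T"
proof -
  let ?S = "{t. 0 \<le> t \<and> x + t *\<^sub>R d \<in> unit_simplex}"
  obtain B where B: "\<And>t. 0 \<le> t \<Longrightarrow> x + t *\<^sub>R d \<in> unit_simplex \<Longrightarrow> t \<le> B"
    using ray_exit_bound[OF assms(1-3)] by blast
  have "?S \<subseteq> {0..B}" using B by auto
  then have "bounded ?S" by (rule bounded_subset[OF bounded_closed_interval])
  moreover have "closed ?S"
  proof -
    have "closed ((\<lambda>t. x + t *\<^sub>R d) -` unit_simplex)"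
      by (intro continuous_closed_vimage closed_unit_simplex continuous_intros)
    then have "closed ({0..} \<inter> (\<lambda>t. x + t *\<^sub>R d) -` unit_simplex)"
      by (intro closed_Int closed_atLeast)
    moreover have "?S = {0..} \<inter> (\<lambda>t. x + t *\<^sub>R d) -` unit_simplex" by auto
    ultimately show ?thesis by simp
  qed
  ultimately have "compact ?S" using compact_eq_bounded_closed by blast
  moreover have "0 \<in> ?S" using x by simp
  ultimately obtain m where m: "m \<in> ?S" "\<And>t. t \<in> ?S \<Longrightarrow> t \<le> m"
    using compact_attains_sup[of ?S] by blast
  have "T = m" unfolding T_def
    by (rule Greatest_equality) (use m in auto)
  then show "x + T *\<^sub>R d \<in> unit_simplex" "\<And>t. 0 \<le> t \<Longrightarrow> x + t *\<^sub>R d \<in> unit_simplex \<Longrightarrow> t \<le> T"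
    using m by auto
qed

text \<open>The step 0 is feasible, so admitting negative steps does not change the maximum.\<close>

lemma max_stepsize_eq_Greatest_nonneg:
  assumes x: "x \<in> unit_simplex" and d: "1 \<bullet> d = 0" "d \<noteq> 0"
  shows "max_stepsize x d = (GREATEST t. 0 \<le> t \<and> x + t *\<^sub>R d \<in> unit_simplex)" (is "_ = ?T")
  unfolding max_stepsize_def
proof (rule Greatest_equality)
  note P = Greatest_ray_properties[OF assms]
  show "x + ?T *\<^sub>R d \<in> unit_simplex" by (rule P(1))
  have "0 \<le> ?T" using P(2)[of 0] x by simp
  then show "t \<le> ?T" if "x + t *\<^sub>R d \<in> unit_simplex" for t
    using P(2)[OF _ that] by (cases "0 \<le> t") auto
qed

lemma max_stepsize_properties:
  assumes "x \<in> unit_simplex" "1 \<bullet> d = 0" "d \<noteq> 0"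
  shows "x + max_stepsize x d *\<^sub>R d \<in> unit_simplex"
    "\<And>t. 0 \<le> t \<Longrightarrow> x + t *\<^sub>R d \<in> unit_simplex \<Longrightarrow> t \<le> max_stepsize x d"
  using Greatest_ray_properties[OF assms] max_stepsize_eq_Greatest_nonneg[OF assms] by auto

text \<open>The ray reaches \<open>z\<close> at parameter 1, hence leaves at some
  \<open>T \<ge> 1\<close>, and \<open>z\<close> sits at fraction \<open>1 / T\<close> of the way.
  Coordinates outside \<open>I\<close> vanish on the whole line through \<open>x\<close> and
  \<open>z\<close>, so the exit point stays in the face.\<close>

lemma exit_point_face:
  assumes x: "x \<in> face I" and z: "z \<in> face I" and ne: "x \<noteq> z"
  obtains t where "t \<in> {0<..1}" "exit_point x z unit_simplex \<in> face I"
    "z = x + t *\<^sub>R (exit_point x z unit_simplex - x)"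
proof -
  define T where "T = (GREATEST t. 0 \<le> t \<and> x + t *\<^sub>R (z - x) \<in> unit_simplex)"
  have xz: "x \<in> unit_simplex" "z \<in> unit_simplex" using x z by (auto simp: face_def)
  then have d: "1 \<bullet> (z - x) = 0" "z - x \<noteq> 0"
    using ne by (auto simp: unit_simplex_def inner_diff_right)
  note P = Greatest_ray_properties[OF xz(1) d, folded T_def]
  have T1: "T \<ge> 1" using P(2)[of 1] xz by simp
  have E: "exit_point x z unit_simplex = x + T *\<^sub>R (z - x)"
    by (simp add: exit_point_def T_def)
  show ?thesis
  proof (rule that[of "1 / T"])
    show "1 / T \<in> {0<..1}" using T1 by simp
    show "exit_point x z unit_simplex \<in> face I"
      using P(1) x z unfolding E by (auto simp: face_def)
    show "z = x + (1 / T) *\<^sub>R (exit_point x z unit_simplex - x)"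
      using T1 by (simp add: E)
  qed
qed

section \<open>Derivatives along lines and convexity\<close>

lemma GDERIV_line:
  assumes "\<And>z. GDERIV f z :> g z"
  shows "((\<lambda>t. f (x + t *\<^sub>R d)) has_real_derivative g (x + t *\<^sub>R d) \<bullet> d) (at t within S)"
proof -
  have "((\<lambda>t. f (x + t *\<^sub>R d)) has_derivative (\<lambda>s. g (x + t *\<^sub>R d) \<bullet> (s *\<^sub>R d))) (at t within S)"
    using assms[of "x + t *\<^sub>R d"] unfolding gderiv_def inner_commute[of _ "g _"]
    by (rule has_derivative_compose[rotated]) (auto intro!: derivative_eq_intros)
  then show ?thesis
    by (simp add: has_field_derivative_def mult.commute[of _ "g _ \<bullet> d"])
qed

text \<open>Convexity bounds each difference quotient by \<open>f y - f x\<close>. The limit is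
  taken from the right, since convexity is available only on the segment from \<open>x\<close> to
  \<open>y\<close>.\<close>

lemma convex_on_above_gradient:
  assumes grad: "\<And>z. GDERIV f z :> g z" and f: "convex_on S f" and "x \<in> S" "y \<in> S"
  shows "f x + g x \<bullet> (y - x) \<le> f y"
proof -
  have "((\<lambda>t. f (x + t *\<^sub>R (y - x))) has_real_derivative g x \<bullet> (y - x)) (at 0 within {0<..})"
    using GDERIV_line[OF grad, of x "y - x" 0 "{0<..}"] by simp
  then have "((\<lambda>t. (f (x + t *\<^sub>R (y - x)) - f x) / t) \<longlongrightarrow> g x \<bullet> (y - x)) (at_right 0)"
    by (simp add: has_field_derivative_iff)
  moreover have "eventually (\<lambda>t. (f (x + t *\<^sub>R (y - x)) - f x) / t \<le> f y - f x) (at_right (0::real))"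
    using eventually_at_right_real[of 0 1, OF zero_less_one]
  proof eventually_elim
    case (elim t)
    have "f ((1 - t) *\<^sub>R x + t *\<^sub>R y) \<le> (1 - t) * f x + t * f y"
      using elim by (intro convex_onD[OF f]) (use assms in auto)
    moreover have "(1 - t) *\<^sub>R x + t *\<^sub>R y = x + t *\<^sub>R (y - x)" by (simp add: algebra_simps)
    ultimately have "f (x + t *\<^sub>R (y - x)) - f x \<le> t * (f y - f x)"
      by (simp add: algebra_simps)
    then show ?case using elim by (simp add: field_simps)
  qed
  ultimately have "g x \<bullet> (y - x) \<le> f y - f x"
    by (intro tendsto_upperbound) (auto simp: trivial_limit_at_right_real)
  then show ?thesis by simp
qed

lemma strongly_convex_on_imp_convex_on:
  assumes "strongly_convex_on S f" "convex S"
  shows "convex_on S f"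
proof -
  obtain m where m: "m > 0" and
    le: "\<And>x y (t::real). \<lbrakk>x \<in> S; y \<in> S; t \<in> {0..1}\<rbrakk> \<Longrightarrow> f (t *\<^sub>R x + (1 - t) *\<^sub>R y)
       \<le> t * f x + (1 - t) * f y - m / 2 * t * (1 - t) * (norm (x - y))\<^sup>2"
    using assms(1) unfolding strongly_convex_on_def by blast
  show ?thesis
  proof (rule convex_onI)
    fix t :: real and x y assume t: "0 < t" "t < 1" and xy: "x \<in> S" "y \<in> S"
    \<comment> \<open>The weight of \<open>x\<close> is \<open>1 - t\<close> here but
      \<open>t\<close> in the strong convexity inequality, which is therefore instantiated at
      \<open>1 - t\<close>.\<close>
    have "0 \<le> m / 2 * (1 - t) * (1 - (1 - t)) * (norm (x - y))\<^sup>2"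
      using m t by (intro mult_nonneg_nonneg) auto
    then show "f ((1 - t) *\<^sub>R x + t *\<^sub>R y) \<le> (1 - t) * f x + t * f y"
      using le[OF xy, of "1 - t"] t by simp
  qed (rule assms(2))
qed

text \<open>The line search admits only positive steps, so the comparison with \<open>f x\<close>
  itself comes from continuity as \<open>t\<close> tends to 0 from the right.\<close>

lemma line_search_no_increase:
  assumes grad: "\<And>z. GDERIV f z :> g z" and "0 < b"
    and le: "\<And>t. \<lbrakk>0 < t; t \<le> b\<rbrakk> \<Longrightarrow> c \<le> f (x + t *\<^sub>R d)"
  shows "c \<le> f x"
proof -
  have "isCont (\<lambda>t. f (x + t *\<^sub>R d)) 0"
    by (rule DERIV_isCont[OF GDERIV_line[OF grad]])
  then have "((\<lambda>t. f (x + t *\<^sub>R d)) \<longlongrightarrow> f x) (at_right 0)"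
    by (auto simp: isCont_def intro: tendsto_mono[OF at_le])
  moreover have "eventually (\<lambda>t. c \<le> f (x + t *\<^sub>R d)) (at_right 0)"
    using eventually_at_right_real[OF \<open>0 < b\<close>] by eventually_elim (use le in auto)
  ultimately show ?thesis
    by (intro tendsto_lowerbound) (auto simp: trivial_limit_at_right_real)
qed

section \<open>Quadratic bounds from the curvature constants\<close>

lemma C_const_upper:
  assumes "x \<in> face I" "s \<in> face I" "t \<in> {0<..1}"
  shows "ereal (curvature_term f g t x (x + t *\<^sub>R (s - x))) \<le> C_const f g I"
  unfolding C_const_def by (rule Sup_upper) (use assms in blast)

text \<open>The choice \<open>s = x\<close> contributes the value 0 to the supremum.\<close>

lemma C_const_nonneg:
  assumes "x \<in> face I"
  shows "0 \<le> C_const f g I"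
  using C_const_upper[OF assms assms, of 1 f g] by (simp add: curvature_term_def zero_ereal_def)

lemma C_const_quadratic_bound:
  assumes "x \<in> face I" "s \<in> face I" "t \<in> {0<..1}" "C_const f g I = ereal c"
  shows "f (x + t *\<^sub>R (s - x)) \<le> f x + t * (g x \<bullet> (s - x)) + t\<^sup>2 / 2 * c"
proof -
  have "2 / t\<^sup>2 * (f (x + t *\<^sub>R (s - x)) - f x - t * (g x \<bullet> (s - x))) \<le> c"
    using C_const_upper[OF assms(1-3), of f g] assms(4) by (simp add: curvature_term_def)
  then show ?thesis using assms(3) by (simp add: field_simps)
qed

text \<open>The pair \<open>s\<close>, \<open>t\<close> is the exit point of the ray through
  \<open>z\<close> and the fraction at which \<open>z\<close> lies on the way to it; the infimum is
  then tested at \<open>y = z\<close>.\<close>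

lemma mu_const_quadratic_bound:
  assumes "x \<in> face I" "z \<in> face I" "x \<noteq> z"
    and m: "ereal m \<le> mu_const f g z I"
  obtains t s where "0 < t" "t \<le> 1" "s \<in> face I"
    "f x + t * (g x \<bullet> (s - x)) + t\<^sup>2 / 2 * m \<le> f z"
proof -
  let ?s = "exit_point x z unit_simplex"
  obtain t where t: "t \<in> {0<..1}" and s: "?s \<in> face I" and z: "z = x + t *\<^sub>R (?s - x)"
    using exit_point_face[OF assms(1-3)] .
  have "mu_const f g z I \<le> ereal (curvature_term f g t x z)"
    unfolding mu_const_def by (rule Inf_lower) (use t z assms in blast)
  then have "m \<le> curvature_term f g t x z"
    using m by (metis ereal_less_eq(3) order_trans)
  moreover have "g x \<bullet> (z - x) = t * (g x \<bullet> (?s - x))"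
    by (subst z) simp
  ultimately have "m \<le> 2 / t\<^sup>2 * (f z - f x - t * (g x \<bullet> (?s - x)))"
    by (simp add: curvature_term_def)
  then have "f x + t * (g x \<bullet> (?s - x)) + t\<^sup>2 / 2 * m \<le> f z"
    using t by (simp add: field_simps)
  then show ?thesis using that[of t ?s] t s by auto
qed

text \<open>
  Holds even when the quotient is \<open>-\<infinity>\<close>, because \<open>real_of_ereal\<close> then returns \<open>0\<close>.
\<close>

lemma rho_AS_FW_le_half: "rho_AS_FW f g z I \<le> 1 / 2"
proof -
  have "min (1 / 2) (mu_const f g z I / C_const f g I) \<le> ereal (1 / 2)"
    by (simp add: one_ereal_def numeral_eq_ereal)
  then show ?thesis unfolding rho_AS_FW_def
    by (cases "min (1 / 2) (mu_const f g z I / C_const f g I)") auto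
qed

text \<open>Turns the extended-real quotient into a real inequality. The product form
  \<open>rho * c\<close> also covers \<open>c = 0\<close>.\<close>

lemma rho_AS_FW_posD:
  assumes pos: "0 < rho_AS_FW f g z I" and C0: "0 \<le> C_const f g I"
  obtains c where "C_const f g I = ereal c" "0 \<le> c"
    "ereal (rho_AS_FW f g z I * c) \<le> mu_const f g z I"
proof -
  let ?r = "rho_AS_FW f g z I" and ?q = "mu_const f g z I / C_const f g I"
  have "(0::ereal) \<le> 1 / 2" by (intro zero_le_divide_ereal) auto
  \<comment> \<open>Division by \<open>\<infinity>\<close> yields 0, which would make the rate
    0.\<close>
  then have "C_const f g I \<noteq> \<infinity>" using pos by (auto simp: rho_AS_FW_def min_absorb2)
  with C0 obtain c where c: "C_const f g I = ereal c" "0 \<le> c" by (cases "C_const f g I") auto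
  \<comment> \<open>The minimum is at most 1/2, and \<open>- \<infinity>\<close> would be sent to 0
    by \<open>real_of_ereal\<close>, against \<open>pos\<close>.\<close>
  have "ereal ?r = min (1 / 2) ?q"
    using pos unfolding rho_AS_FW_def
    by (cases "min (1 / 2) ?q") auto
  then have q: "ereal ?r \<le> ?q" by (metis min.cobounded2)
  have "ereal (?r * c) \<le> mu_const f g z I"
  proof (cases "c = 0")
    case False
    then show ?thesis using q c
      by (cases "mu_const f g z I") (auto simp: field_simps)
  next
    case True
    have "0 \<le> mu_const f g z I"
    proof (rule ccontr)
      assume "\<not> ?thesis"
      \<comment> \<open>The extended-real inverse of 0 is \<open>\<infinity>\<close>, so a negative
        numerator gives \<open>- \<infinity>\<close>.\<close>
      then have "?q = - \<infinity>" using c True by (cases "mu_const f g z I") auto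
      then show False using q by simp
    qed
    then show ?thesis using True by (simp add: zero_ereal_def)
  qed
  then show ?thesis using that c by blast
qed

section \<open>Contraction by one Frank-Wolfe step on a face\<close>

lemma Frank_Wolfe_contraction:
  assumes grad: "\<And>z. GDERIV f z :> g z" and conv: "convex_on (face I) f"
    and x: "x \<in> face I" and z: "z \<in> face I" and s: "s \<in> face I"
    and s_min: "\<And>y. y \<in> face I \<Longrightarrow> g x \<bullet> s \<le> g x \<bullet> y"
    and z_min: "\<And>y. y \<in> face I \<Longrightarrow> f z \<le> f y"
    and v: "\<And>t. t \<in> {0<..1} \<Longrightarrow> v \<le> f (x + t *\<^sub>R (s - x))"
  shows "v - f z \<le> (1 - rho_AS_FW f g z I) * (f x - f z)"
proof -
  let ?r = "rho_AS_FW f g z I"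
  define G where "G = - (g x \<bullet> (s - x))"
  define h where "h = f x - f z"
  have h0: "0 \<le> h" using z_min[OF x] by (simp add: h_def)
  have G_ge: "- (g x \<bullet> (y - x)) \<le> G" if "y \<in> face I" for y
    using s_min[OF that] by (simp add: G_def inner_diff_right)
  have hG: "h \<le> G"
    using convex_on_above_gradient[OF grad conv x z] G_ge[OF z] by (simp add: h_def)
  have vx: "v \<le> f x" by (rule line_search_no_increase[OF grad, of 1]) (use v in auto)
  have "v - f z \<le> (1 - ?r) * h"
  \<comment> \<open>If the rate is nonpositive or \<open>h = 0\<close>, the right side is at least
    \<open>h\<close> and \<open>v \<le> f x\<close> suffices.\<close>
  proof (cases "0 < ?r \<and> x \<noteq> z")
    case False
    then have "?r * h \<le> 0" using h0 by (auto simp: h_def mult_nonpos_nonneg)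
    then show ?thesis using vx by (simp add: h_def algebra_simps)
  next
    case True
    then have r: "0 < ?r" and ne: "x \<noteq> z" by auto
    obtain c where c: "C_const f g I = ereal c" "0 \<le> c" and m: "ereal (?r * c) \<le> mu_const f g z I"
      using rho_AS_FW_posD[OF r C_const_nonneg[OF x]] .
    have dec: "v - f z \<le> h - t * G + t\<^sup>2 / 2 * c" if "t \<in> {0<..1}" for t
      using v[OF that] C_const_quadratic_bound[OF x s that c(1)] by (simp add: G_def h_def)
    show ?thesis
    \<comment> \<open>For \<open>c < G\<close> the full step \<open>t = 1\<close> leaves at most
      \<open>h - G / 2 \<le> h / 2\<close>; for \<open>G = 0\<close> also \<open>h = 0\<close>.
      Otherwise \<open>0 < G \<le> c\<close>, so division by \<open>c\<close> is safe.\<close>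
    proof (cases "c < G \<or> G = 0")
      case True
      have "?r * h \<le> h / 2" using rho_AS_FW_le_half[of f g z I] h0 mult_right_mono by fastforce
      moreover have "v - f z \<le> h / 2"
        using dec[of 1] True hG h0 vx h_def by auto
      ultimately show ?thesis by (simp add: algebra_simps)
    next
      case False
      then have G: "0 < G" "G \<le> c" using hG h0 by auto
      obtain t s' where t: "0 < t" "t \<le> 1" and s': "s' \<in> face I"
        and le: "f x + t * (g x \<bullet> (s' - x)) + t\<^sup>2 / 2 * (?r * c) \<le> f z"
        using mu_const_quadratic_bound[OF x z ne m] .
      have "t * - (g x \<bullet> (s' - x)) \<le> t * G" using G_ge[OF s'] t by (intro mult_left_mono) auto
      then have "h \<le> t * G - t\<^sup>2 / 2 * (?r * c)" using le by (simp add: h_def)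
      \<comment> \<open>Multiplying by \<open>?r * c\<close> allows completing the square, which
        removes the unknown \<open>t\<close>.\<close>
      then have "(?r * c) * h \<le> (?r * c) * (t * G - t\<^sup>2 / 2 * (?r * c))"
        using r c by (intro mult_left_mono) auto
      also have "\<dots> = G\<^sup>2 / 2 - (G - t * (?r * c))\<^sup>2 / 2"
        by (simp add: power2_eq_square field_simps)
      also have "\<dots> \<le> G\<^sup>2 / 2" by simp
      finally have "?r * h \<le> G\<^sup>2 / (2 * c)" using G by (simp add: field_simps)
      \<comment> \<open>The step \<open>G / c\<close> minimizes the quadratic upper bound and is
        admissible because \<open>0 < G \<le> c\<close>.\<close>
      moreover have "v - f z \<le> h - G\<^sup>2 / (2 * c)"
        using dec[of "G / c"] G by (simp add: power2_eq_square field_simps)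
      ultimately show ?thesis by (simp add: algebra_simps)
    qed
  qed
  then show ?thesis by (simp add: h_def)
qed

section \<open>Stationary points\<close>

lemma stationary_gradient:
  assumes "stationary g x"
  shows "lam_mult g x \<le> g x $ i" "0 < x $ i \<Longrightarrow> g x $ i = lam_mult g x"
proof -
  obtain lam mu where x: "x \<in> unit_simplex" and eq: "g x - lam *\<^sub>R 1 - mu = 0"
    and c: "mu \<bullet> x = 0" and mu: "\<And>i. 0 \<le> mu $ i"
    using assms unfolding stationary_def by blast
  have gx: "g x = lam *\<^sub>R 1 + mu" using eq by (simp add: algebra_simps)
  \<comment> \<open>Pairing with \<open>x\<close> removes \<open>mu\<close> by complementarity and
    keeps \<open>lam\<close>, since \<open>x\<close> sums to 1.\<close>
  have lam: "lam_mult g x = lam"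
    using x c unfolding lam_mult_def by (subst gx) (simp add: inner_add_left unit_simplex_def)
  have comp: "g x $ i = lam + mu $ i" for i by (subst gx) simp
  show "lam_mult g x \<le> g x $ i" using comp mu lam by simp
  assume "0 < x $ i"
  have "(\<Sum>i\<in>UNIV. mu $ i * x $ i) = 0" using c by (simp add: inner_vec_def)
  then have "mu $ i * x $ i = 0"
    using mu x by (subst (asm) sum_nonneg_eq_0_iff) (auto simp: unit_simplex_def)
  then show "g x $ i = lam_mult g x" using \<open>0 < x $ i\<close> comp lam by simp
qed

text \<open>All gradient components at \<open>z\<close> are at least the multiplier, which equals
  \<open>g z \<bullet> z\<close>. So no direction into the face is a descent direction, and
  convexity makes \<open>z\<close> a minimizer there.\<close>

lemma stationary_minimizes_on_face:
  assumes grad: "\<And>z. GDERIV f z :> g z" and conv: "convex_on (face I) f"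
    and z: "stationary g z" "z \<in> face I" and y: "y \<in> face I"
  shows "f z \<le> f y"
proof -
  have "lam_mult g z \<le> g z \<bullet> y"
    by (rule inner_ge_on_face[OF y]) (rule stationary_gradient(1)[OF z(1)])
  then have "0 \<le> g z \<bullet> (y - z)" by (simp add: inner_diff_right lam_mult_def)
  then show ?thesis using convex_on_above_gradient[OF grad conv z(2) y] by simp
qed

lemma stationary_in_face: "stationary g z \<Longrightarrow> z \<in> face {i. 0 < z $ i}"
  by (auto simp: stationary_def face_def unit_simplex_iff order.order_iff_strict)

lemma strict_complementarity_gradient:
  assumes "stationary g z" "strict_complementarity g z" "\<not> 0 < z $ i"
  shows "lam_mult g z < g z $ i"
proof -
  have "z $ i = 0" using stationary_in_face[OF assms(1)] assms(3) by (auto simp: face_def)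
  then show ?thesis using assms(2) by (auto simp: strict_complementarity_def mu_mult_def)
qed

section \<open>The active-set estimate and the shift of mass\<close>

lemma nonactive_set_eq_Compl: "nonactive_set g eps x = - active_set g eps x"
  by (auto simp: nonactive_set_def active_set_def)

lemma tilde_point_diff:
  assumes "j \<notin> A"
  shows "tilde_point A j x - x = (\<Sum>h\<in>A. x $ h *\<^sub>R (axis j 1 - axis h 1))"
proof (rule vec_eq_iff[THEN iffD2], rule allI)
  fix i
  have "(\<Sum>h\<in>A. x $ h * (if i = h then 1 else 0)) = (if i \<in> A then x $ i else 0)"
    by (simp add: if_distrib sum.delta cong: if_cong)
  then show "(tilde_point A j x - x) $ i = (\<Sum>h\<in>A. x $ h *\<^sub>R (axis j 1 - axis h 1)) $ i"
    using assms
    by (auto simp: tilde_point_def axis_def right_diff_distrib sum_subtractf)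
qed

lemma norm_tilde_point_diff_le:
  assumes "j \<notin> A"
  shows "norm (tilde_point A j x - x) \<le> (\<Sum>h\<in>A. 2 * \<bar>x $ h\<bar>)"
proof -
  have "norm (axis j 1 - axis h (1::real)) \<le> 2" for h
    by (rule order_trans[OF norm_triangle_ineq4]) (simp add: norm_axis_1)
  then have "norm (x $ h *\<^sub>R (axis j 1 - axis h (1::real))) \<le> 2 * \<bar>x $ h\<bar>" for h
    by (simp add: mult.commute[of 2] mult_left_mono)
  then show ?thesis unfolding tilde_point_diff[OF assms] by (intro sum_norm_le)
qed

text \<open>By the mean value theorem the change of \<open>f\<close> is a sum of terms
  \<open>x $ h * (g $ j - g $ h)\<close> at an intermediate point. Convexity of \<open>S\<close>
  keeps that point where the order of the gradient components is known.\<close>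

lemma tilde_point_decrease:
  assumes grad: "\<And>z. GDERIV f z :> g z" and "j \<notin> A"
    and x: "\<And>h. 0 \<le> x $ h"
    and S: "convex S" "x \<in> S" "tilde_point A j x \<in> S"
    and gS: "\<And>z h. z \<in> S \<Longrightarrow> h \<in> A \<Longrightarrow> g z $ j \<le> g z $ h"
  shows "f (tilde_point A j x) \<le> f x"
proof -
  let ?d = "tilde_point A j x - x"
  have "\<exists>t>0. t < 1 \<and> f (x + 1 *\<^sub>R ?d) - f (x + 0 *\<^sub>R ?d) = (1 - 0) * (g (x + t *\<^sub>R ?d) \<bullet> ?d)"
    by (rule MVT2) (auto intro: GDERIV_line[OF grad])
  then obtain t where t: "0 < t" "t < 1"
    and eq: "f (tilde_point A j x) - f x = g (x + t *\<^sub>R ?d) \<bullet> ?d" by auto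
  have "x + t *\<^sub>R ?d \<in> S"
    by (rule segment_in_convex[OF S(1,2), of 1]) (use S t in auto)
  then have "x $ h * (g (x + t *\<^sub>R ?d) $ j - g (x + t *\<^sub>R ?d) $ h) \<le> 0" if "h \<in> A" for h
    using gS[OF _ that] x[of h] by (intro mult_nonneg_nonpos) auto
  moreover have "g (x + t *\<^sub>R ?d) \<bullet> ?d
      = (\<Sum>h\<in>A. x $ h * (g (x + t *\<^sub>R ?d) $ j - g (x + t *\<^sub>R ?d) $ h))"
    by (subst (2) tilde_point_diff[OF \<open>j \<notin> A\<close>])
      (simp add: inner_sum_right inner_diff_right inner_axis)
  ultimately have "g (x + t *\<^sub>R ?d) \<bullet> ?d \<le> 0" by (simp add: sum_nonpos)
  then show ?thesis using eq by simp
qed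

text \<open>At \<open>z\<close> the difference that defines the estimate is \<open>z $ i > 0\<close>
  on the support and \<open>- eps\<close> times a positive multiplier off it. Both signs are strict,
  hence stable under small perturbations.\<close>

lemma eventually_active_set_eq:
  fixes z :: "real ^ 'n"
  assumes cont: "continuous_on UNIV g" and "0 < eps"
    and z: "stationary g z" "strict_complementarity g z"
  shows "eventually (\<lambda>x. active_set g eps x = - {i. 0 < z $ i}) (nhds z)"
proof -
  have g: "(g \<longlongrightarrow> g z) (nhds z)"
    using cont by (simp add: continuous_on_eq_continuous_at isCont_def tendsto_at_iff_tendsto_nhds)
  have id: "((\<lambda>x. x) \<longlongrightarrow> z) (nhds z)" by (rule filterlim_ident)
  have lim: "((\<lambda>x. x $ i - eps * (g x \<bullet> (axis i 1 - x)))
      \<longlongrightarrow> z $ i - eps * (g z $ i - lam_mult g z)) (nhds z)" for i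
  proof -
    have "((\<lambda>x. x $ i - eps * (g x \<bullet> (axis i 1 - x)))
        \<longlongrightarrow> z $ i - eps * (g z \<bullet> (axis i 1 - z))) (nhds z)"
      by (intro tendsto_intros g id)
    then show ?thesis by (simp add: inner_diff_right inner_axis lam_mult_def)
  qed
  have "eventually (\<lambda>x. i \<in> active_set g eps x \<longleftrightarrow> \<not> 0 < z $ i) (nhds z)" for i
  proof (cases "0 < z $ i")
    case True
    then have "eventually (\<lambda>x. 0 < x $ i - eps * (g x \<bullet> (axis i 1 - x))) (nhds z)"
      using stationary_gradient(2)[OF z(1) True] by (intro order_tendstoD(1)[OF lim]) simp
    then show ?thesis by eventually_elim (use True in \<open>auto simp: active_set_def\<close>)
  next
    case False
    have "0 < eps * (g z $ i - lam_mult g z)"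
      using strict_complementarity_gradient[OF z False] \<open>0 < eps\<close> by simp
    then have "eventually (\<lambda>x. x $ i - eps * (g x \<bullet> (axis i 1 - x)) < 0) (nhds z)"
      using False by (intro order_tendstoD(2)[OF lim]) simp
    then show ?thesis by eventually_elim (use False in \<open>auto simp: active_set_def\<close>)
  qed
  then have "eventually (\<lambda>x. \<forall>i. i \<in> active_set g eps x \<longleftrightarrow> \<not> 0 < z $ i) (nhds z)"
    by (intro eventually_all_finite)
  then show ?thesis by eventually_elim auto
qed

lemma eventually_gradient_gap:
  fixes z :: "real ^ 'n"
  assumes cont: "continuous_on UNIV g"
    and z: "stationary g z" "strict_complementarity g z"
  shows "eventually (\<lambda>x. \<forall>i h. 0 < z $ i \<longrightarrow> \<not> 0 < z $ h \<longrightarrow> g x $ i < g x $ h) (nhds z)"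
proof -
  have g: "(g \<longlongrightarrow> g z) (nhds z)"
    using cont by (simp add: continuous_on_eq_continuous_at isCont_def tendsto_at_iff_tendsto_nhds)
  have "eventually (\<lambda>x. 0 < z $ i \<longrightarrow> \<not> 0 < z $ h \<longrightarrow> g x $ i < g x $ h) (nhds z)" for i h
  proof (cases "0 < z $ i \<and> \<not> 0 < z $ h")
    case True
    then have "0 < g z $ h - g z $ i"
      using stationary_gradient(2)[OF z(1)] strict_complementarity_gradient[OF z] by simp
    moreover have "((\<lambda>x. g x $ h - g x $ i) \<longlongrightarrow> g z $ h - g z $ i) (nhds z)"
      by (intro tendsto_intros g)
    ultimately have "eventually (\<lambda>x. 0 < g x $ h - g x $ i) (nhds z)"
      by (rule order_tendstoD(1)[rotated])
    then show ?thesis by eventually_elim simp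
  qed auto
  then show ?thesis by (intro eventually_all_finite)
qed

section \<open>Steps of the algorithm and the eventual linear rate\<close>

lemma as_simplex_step_in_unit_simplex:
  assumes "as_simplex_step g eps dir ls x x'"
  shows "x' \<in> unit_simplex"
proof -
  obtain xt d a where fd: "feasible_direction xt d"
    and a: "if g xt \<bullet> d < 0 then a \<in> {0<..max_stepsize xt d} \<and> ls xt d a else a = 0"
    and x': "x' = xt + a *\<^sub>R d"
    using assms unfolding as_simplex_step_def Let_def by blast
  obtain b where b: "b > 0" "\<And>t. t \<in> {0..b} \<Longrightarrow> xt + t *\<^sub>R d \<in> unit_simplex"
    using fd unfolding feasible_direction_def by blast
  have xt: "xt \<in> unit_simplex" using b(2)[of 0] b(1) by simp
  show ?thesis
  proof (cases "g xt \<bullet> d < 0")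
    case True
    then have "d \<noteq> 0" by auto
    \<comment> \<open>Two feasible points on the line have the same coordinate sum, so
      \<open>d\<close> sums to 0.\<close>
    have "1 \<bullet> (xt + b *\<^sub>R d) = 1" "1 \<bullet> xt = 1"
      using b(2)[of b] b(1) xt by (auto simp: unit_simplex_def)
    then have "1 \<bullet> d = 0" using b(1) by (simp add: inner_add_right)
    with \<open>d \<noteq> 0\<close> have "xt + max_stepsize xt d *\<^sub>R d \<in> unit_simplex"
      by (intro max_stepsize_properties(1) xt)
    then show ?thesis unfolding x'
      by (rule segment_in_convex[OF convex_unit_simplex xt]) (use a True in auto)
  qed (use a x' xt in auto)
qed

lemma Frank_Wolfe_step_contraction:
  assumes grad: "\<And>z. GDERIV f z :> g z" and conv: "convex_on (face I) f"
    and z: "stationary g z" "z \<in> face I"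
    and xt: "xt \<in> face I"
    and dir: "fw_direction g (- I) I xt d"
    and ls: "if g xt \<bullet> d < 0 then exact_line_search f xt d a else a = 0"
  shows "f (xt + a *\<^sub>R d) - f z \<le> (1 - rho_AS_FW f g z I) * (f xt - f z)"
proof -
  obtain i where i: "is_arg_min (\<lambda>i. g xt $ i) (\<lambda>i. i \<in> I) i"
    and d0: "\<And>k. k \<in> - I \<Longrightarrow> d $ k = 0" and d1: "\<And>k. k \<in> I \<Longrightarrow> d $ k = (axis i 1 - xt) $ k"
    using dir unfolding fw_direction_def by blast
  have iI: "i \<in> I" and gmin: "\<And>k. k \<in> I \<Longrightarrow> g xt $ i \<le> g xt $ k"
    using i by (auto simp: is_arg_min_linorder)
  let ?s = "axis i 1 :: real ^ 'a"
  have s: "?s \<in> face I" by (rule axis_in_face[OF iI])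
  have d: "d = ?s - xt"
  proof (rule vec_eq_iff[THEN iffD2], rule allI)
    fix k show "d $ k = (?s - xt) $ k"
      using d0[of k] d1[of k] xt s by (cases "k \<in> I") (auto simp: face_def)
  qed
  have s_min: "g xt \<bullet> ?s \<le> g xt \<bullet> y" if "y \<in> face I" for y
    using inner_ge_on_face[OF that gmin] by (simp add: inner_axis)
  have z_min: "f z \<le> f y" if "y \<in> face I" for y
    by (rule stationary_minimizes_on_face[OF grad conv z that])
  show ?thesis
  proof (cases "g xt \<bullet> d < 0")
    case True
    then have ls': "\<And>t. t \<in> {0<..max_stepsize xt d} \<Longrightarrow> f (xt + a *\<^sub>R d) \<le> f (xt + t *\<^sub>R d)"
      using ls by (auto simp: exact_line_search_def is_arg_min_linorder)
    have xt': "xt \<in> unit_simplex" and s': "?s \<in> unit_simplex"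
      using xt s face_subset_unit_simplex by blast+
    then have "1 \<bullet> d = 0" by (simp add: d unit_simplex_def inner_diff_right)
    \<comment> \<open>The step 1 leads to the vertex \<open>?s\<close>, so the search interval
      contains all steps in \<open>{0<..1}\<close>.\<close>
    then have "1 \<le> max_stepsize xt d"
      using True s' by (intro max_stepsize_properties(2) xt') (auto simp: d)
    then have "f (xt + a *\<^sub>R d) \<le> f (xt + t *\<^sub>R (?s - xt))" if "t \<in> {0<..1}" for t
      using ls'[of t] that by (simp add: d)
    then show ?thesis
      by (intro Frank_Wolfe_contraction[OF grad conv xt z(2) s s_min z_min])
  next
    case False
    \<comment> \<open>Without descent the Frank-Wolfe gap is not positive, so \<open>xt\<close>
      already has the optimal value and the step 0 keeps it.\<close>
    then have "0 \<le> g xt \<bullet> (z - xt)" using s_min[OF z(2)] by (simp add: d inner_diff_right)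
    then have "f xt = f z"
      using convex_on_above_gradient[OF grad conv xt z(2)] z_min[OF xt] by simp
    then show ?thesis using False ls by simp
  qed
qed

theorem theorem3:
  fixes f :: "real ^ 'n \<Rightarrow> real" and g :: "real ^ 'n \<Rightarrow> real ^ 'n"
    and L C eps :: real and x :: "nat \<Rightarrow> real ^ 'n" and xs :: "real ^ 'n" and Nbar :: "'n set"
  assumes grad: "\<And>z. GDERIV f z :> g z"
    and grad_cont: "continuous_on UNIV g"
    and L_pos: "L > 0"
    and grad_lipschitz: "L-lipschitz_on unit_simplex g"
    and C_pos: "C > 0"
    and eps_pos: "0 < eps"
    and eps_le: "eps \<le> 2 / (real CARD('n) * L * (2 * C + 1))"
    and run: "as_simplex_infinite_run g eps (fw_direction g) (exact_line_search f) x"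
    and lim: "x \<longlonglongrightarrow> xs"
    and stat: "stationary g xs"
    and Nbar: "Nbar = {i. xs $ i > 0}"
    and strong: "strongly_convex_on (face Nbar) f"
    and strict: "strict_complementarity g xs"
  shows "\<exists>kbar. \<forall>k\<ge>kbar.
           f (x (Suc k)) - f xs \<le> (1 - rho_AS_FW f g xs Nbar) * (f (x k) - f xs)"
proof -
  have conv: "convex_on (face Nbar) f"
    by (rule strongly_convex_on_imp_convex_on[OF strong convex_face])
  have xs: "xs \<in> face Nbar" using stationary_in_face[OF stat] by (simp add: Nbar)
  have xs_min: "f xs \<le> f y" if "y \<in> face Nbar" for y
    by (rule stationary_minimizes_on_face[OF grad conv stat xs that])
  have step: "as_simplex_step g eps (fw_direction g) (exact_line_search f) (x k) (x (Suc k))" for k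
    using run by (simp add: as_simplex_infinite_run_def)
  have x: "x k \<in> unit_simplex" for k
    using run as_simplex_step_in_unit_simplex[OF step]
    by (cases k) (auto simp: as_simplex_infinite_run_def)
  have "\<exists>i. 0 < xs $ i"
  proof (rule ccontr)
    assume "\<not> ?thesis"
    then have "\<forall>i. xs $ i = 0" using xs by (simp add: Nbar face_def)
    then show False using stat by (simp add: stationary_def unit_simplex_iff)
  qed
  then obtain i0 where i0: "i0 \<in> Nbar" by (auto simp: Nbar)
  obtain r where r: "0 < r"
    and gap: "\<And>y i h. \<lbrakk>dist y xs < r; i \<in> Nbar; h \<notin> Nbar\<rbrakk> \<Longrightarrow> g y $ i < g y $ h"
    using eventually_gradient_gap[OF grad_cont stat strict]
    unfolding eventually_nhds_metric Nbar by auto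
  have act: "eventually (\<lambda>k. active_set g eps (x k) = - Nbar) sequentially"
    using eventually_compose_filterlim[OF eventually_active_set_eq[OF grad_cont eps_pos stat strict] lim]
    by (simp add: Nbar)
  \<comment> \<open>One half of the radius is for the iterate, the other for its displacement to the
    tilde point, so both lie in the ball where \<open>gap\<close> holds.\<close>
  have near: "eventually (\<lambda>k. dist (x k) xs < r / 2) sequentially"
    using tendstoD[OF lim, of "r / 2"] r by simp
  have "(\<lambda>k. \<Sum>h\<in>- Nbar. 2 * \<bar>x k $ h\<bar>) \<longlonglongrightarrow> (\<Sum>h\<in>- Nbar. 2 * \<bar>xs $ h\<bar>)"
    by (intro tendsto_intros lim)
  also have "(\<Sum>h\<in>- Nbar. 2 * \<bar>xs $ h\<bar>) = 0" using xs by (simp add: face_def)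
  finally have "eventually (\<lambda>k. (\<Sum>h\<in>- Nbar. 2 * \<bar>x k $ h\<bar>) < r / 2) sequentially"
    using r by (intro order_tendstoD(2)) auto
  with act near have "eventually (\<lambda>k. f (x (Suc k)) - f xs
      \<le> (1 - rho_AS_FW f g xs Nbar) * (f (x k) - f xs)) sequentially"
  proof eventually_elim
    case (elim k)
    have N: "nonactive_set g eps (x k) = Nbar"
      by (simp add: nonactive_set_eq_Compl elim(1))
    obtain j xt d a where j: "j \<in> min_grad_set g (x k)"
      and xt: "xt = tilde_point (- Nbar) j (x k)"
      and fd: "feasible_direction xt d"
      and dir: "fw_direction g (- Nbar) Nbar xt d"
      and a: "if g xt \<bullet> d < 0 then a \<in> {0<..max_stepsize xt d} \<and> exact_line_search f xt d a else a = 0"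
      and x': "x (Suc k) = xt + a *\<^sub>R d"
      using step[of k] unfolding as_simplex_step_def Let_def elim(1) N by blast
    \<comment> \<open>Near \<open>xs\<close> an index outside \<open>Nbar\<close> cannot minimize
      the gradient, because \<open>i0\<close> has a strictly smaller component.\<close>
    have jN: "j \<notin> - Nbar"
    proof
      assume "j \<in> - Nbar"
      then have "g (x k) $ i0 < g (x k) $ j" using gap[of "x k" i0 j] i0 elim(2) r by auto
      then show False using j by (auto simp: min_grad_set_def is_arg_min_def)
    qed
    obtain b where "0 < b" "\<And>t. t \<in> {0..b} \<Longrightarrow> xt + t *\<^sub>R d \<in> unit_simplex"
      using fd unfolding feasible_direction_def by blast
    from this(2)[of 0] this(1) have "xt \<in> unit_simplex" by simp
    then have xt_face: "xt \<in> face Nbar" by (simp add: face_def xt tilde_point_def)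
    have "dist xt xs < r"
      using norm_tilde_point_diff_le[OF jN, of "x k"] elim(2,3)
        dist_triangle_half_r[of "x k" xt r xs]
      by (simp add: xt dist_norm norm_minus_commute)
    then have dec: "f xt \<le> f (x k)"
      unfolding xt using r elim(2) x[of k] jN
      by (intro tilde_point_decrease[OF grad jN, of _ "ball xs r"])
        (auto simp: dist_commute unit_simplex_def intro!: less_imp_le gap)
    have "f (x (Suc k)) - f xs \<le> (1 - rho_AS_FW f g xs Nbar) * (f xt - f xs)"
      unfolding x' using a
      by (intro Frank_Wolfe_step_contraction[OF grad conv stat xs xt_face dir]) (auto split: if_splits)
    \<comment> \<open>The factor is nonnegative since the rate is at most 1/2, so the decrease from
      \<open>x k\<close> to \<open>xt\<close> carries over.\<close>
    also have "\<dots> \<le> (1 - rho_AS_FW f g xs Nbar) * (f (x k) - f xs)"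
      using dec rho_AS_FW_le_half[of f g xs Nbar] by (intro mult_left_mono) auto
    finally show ?case .
  qed
  then show ?thesis by (simp add: eventually_sequentially)
qed

end
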